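(* Let $\mathcal{A}$ be an independence algebra with universe $A$ and let $\mathcal{B}$ be a non-empty subalgebra of $\mathcal{A}$ with universe $B$. Assume $\mathcal{B}\neq\mathcal{A}$ and that either $\dim B\geq 2$, or $\langle\emptyset\rangle\neq\emptyset$ and $\dim B=1$. Let $T(\mathcal{A},\mathcal{B})$ be the semigroup of all endomorphisms of $\mathcal{A}$ whose image is contained in $B$, and let $Q=\{\alpha\in T(\mathcal{A},\mathcal{B}): A\alpha\subseteq B\alpha\}$. For $\alpha,\beta\in T(\mathcal{A},\mathcal{B})$ we have $\alpha\,\mathcal{R}^*\,\beta$ in $T(\mathcal{A},\mathcal{B})$ if and only if one of the following occurs: 1. $\ker\alpha=\ker\beta$ and $\alpha,\beta\in Q$; 2. $\ker\alpha\cap(B\times B)=\ker\beta\cap(B\times B)$ and $\alpha,\beta\notin Q$.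
   Context: An algebra $\mathcal{A}=\langle A;F\rangle$ has a non-empty universe $A$ and a set $F$ of finitary operations. For $X\subseteq A$, $\langle X\rangle$ is the set of all $t(a_1,\dots,a_n)$ with $t$ a term operation and $a_i\in X$ (the subalgebra generated by $X$); $\langle\emptyset\rangle$ is the set of constants, i.e. values of nullary term operations (possibly empty). $X$ is independent if $x\notin\langle X\setminus\{x\}\rangle$ for all $x\in X$; a basis of a subalgebra is an independent generating set. Exchange property (EP): for all $X\subseteq A$ and $a,b\in A$, if $b\in\langle X\cup\{a\}\rangle$ and $b\notin\langle X\rangle$ then $a\in\langle X\cup\{b\}\rangle$. Under (EP) every subalgebra has a basis, all its bases have the same cardinality (its dimension, $\dim$), and independent sets extend to bases. Free basis property (F): every map from a basis of $\mathcal{A}$ to $A$ extends to an endomorphism of $\mathcal{A}$. An independence algebra is an algebra satisfying (EP) and (F). Dimensions may be finite or infinite. Maps are written on the right and composed left to right. $\ker\alpha=\{(x,y)\in A\times A: x\alpha=y\alpha\}$. For a semigroup $S$ and $a,b\in S$: $a\,\mathcal{R}^*\,b$ iff for all $x,y\in S^1$, $xa=ya\Leftrightarrow xb=yb$ (where $S^1$ is $S$ with an identity adjoined if necessary). *)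

theory Defs
  imports Main "HOL-Library.FuncSet"
begin

unbundle cardinal_syntax

text \<open>
  A finitary operation on a set \<open>A\<close> is given as a pair \<open>(n, f)\<close> of its arity and a function on
  argument lists; only the values of \<open>f\<close> on lists of length \<open>n\<close> with entries in \<open>A\<close> matter.
  Arity \<open>0\<close> is allowed.
\<close>

type_synonym 'a operation = "nat \<times> ('a list \<Rightarrow> 'a)"

locale univ_algebra =
  fixes A :: "'a set" and F :: "'a operation set"
  assumes universe_nonempty: "A \<noteq> {}"
    and ops_closed: "\<And>n f as. (n, f) \<in> F \<Longrightarrow> length as = n \<Longrightarrow> set as \<subseteq> A \<Longrightarrow> f as \<in> A"

inductive term_op :: "'a operation set \<Rightarrow> nat \<Rightarrow> ('a list \<Rightarrow> 'a) \<Rightarrow> bool"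
  for F :: "'a operation set" and n :: nat where
  proj: "i < n \<Longrightarrow> term_op F n (\<lambda>as. as ! i)"
| comp: "(m, f) \<in> F \<Longrightarrow> length ts = m \<Longrightarrow> \<forall>t\<in>set ts. term_op F n t
    \<Longrightarrow> term_op F n (\<lambda>as. f (map (\<lambda>t. t as) ts))"

text \<open>For \<open>X = {}\<close> only \<open>as = []\<close> contributes, i.e. the values of the nullary term operations.\<close>

definition gen :: "'a operation set \<Rightarrow> 'a set \<Rightarrow> 'a set" where
  "gen F X = {t as | t as. term_op F (length as) t \<and> set as \<subseteq> X}"

definition subalgebra :: "'a set \<Rightarrow> 'a operation set \<Rightarrow> 'a set \<Rightarrow> bool" where
  "subalgebra A F B \<longleftrightarrow> B \<subseteq> A \<and>
     (\<forall>n f as. (n, f) \<in> F \<longrightarrow> length as = n \<longrightarrow> set as \<subseteq> B \<longrightarrow> f as \<in> B)"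

definition indep :: "'a operation set \<Rightarrow> 'a set \<Rightarrow> bool" where
  "indep F X \<longleftrightarrow> (\<forall>x\<in>X. x \<notin> gen F (X - {x}))"

definition is_basis :: "'a operation set \<Rightarrow> 'a set \<Rightarrow> 'a set \<Rightarrow> bool" where
  "is_basis F B X \<longleftrightarrow> X \<subseteq> B \<and> indep F X \<and> gen F X = B"

text \<open>
  The dimension is a cardinal, possibly infinite, in the sense of the library's cardinal orders
  and hence to be compared by \<open>\<le>o\<close> and \<open>=o\<close>. It does not depend on the chosen basis when the
  exchange property holds.
\<close>

definition alg_dim :: "'a operation set \<Rightarrow> 'a set \<Rightarrow> 'a rel" where
  "alg_dim F B = card_of (SOME X. is_basis F B X)"

text \<open>
  Endomorphisms are extensional functions on \<open>A\<close>, so that HOL equality is equality of maps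
  from \<open>A\<close> to \<open>A\<close>.
\<close>

definition endo :: "'a set \<Rightarrow> 'a operation set \<Rightarrow> ('a \<Rightarrow> 'a) set" where
  "endo A F = {h \<in> A \<rightarrow>\<^sub>E A.
     \<forall>n f as. (n, f) \<in> F \<longrightarrow> length as = n \<longrightarrow> set as \<subseteq> A \<longrightarrow> h (f as) = f (map h as)}"

locale independence_algebra = univ_algebra +
  assumes exchange: "\<And>X a b. X \<subseteq> A \<Longrightarrow> a \<in> A \<Longrightarrow> b \<in> A \<Longrightarrow>
      b \<in> gen F (insert a X) \<Longrightarrow> b \<notin> gen F X \<Longrightarrow> a \<in> gen F (insert b X)"
    and free_basis: "\<And>X g. is_basis F A X \<Longrightarrow> g \<in> X \<rightarrow> A \<Longrightarrow> \<exists>h\<in>endo A F. \<forall>x\<in>X. h x = g x"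

text \<open>
  For a semigroup with carrier \<open>S\<close> and multiplication \<open>m\<close>, the monoid \<open>S\<^sup>1\<close> is realised inside the
  option type: \<open>None\<close> is the adjoined identity, present only if \<open>S\<close> has no identity.
\<close>

definition S1_carrier :: "'s set \<Rightarrow> ('s \<Rightarrow> 's \<Rightarrow> 's) \<Rightarrow> 's option set" where
  "S1_carrier S m =
     (if \<exists>e\<in>S. \<forall>x\<in>S. m e x = x \<and> m x e = x then Some ` S else insert None (Some ` S))"

fun S1_mult :: "('s \<Rightarrow> 's \<Rightarrow> 's) \<Rightarrow> 's option \<Rightarrow> 's option \<Rightarrow> 's option" where
  "S1_mult m None y = y"
| "S1_mult m (Some x) None = Some x"
| "S1_mult m (Some x) (Some y) = Some (m x y)"

definition R_star :: "'s set \<Rightarrow> ('s \<Rightarrow> 's \<Rightarrow> 's) \<Rightarrow> 's \<Rightarrow> 's \<Rightarrow> bool" where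
  "R_star S m a b \<longleftrightarrow> a \<in> S \<and> b \<in> S \<and>
     (\<forall>x\<in>S1_carrier S m. \<forall>y\<in>S1_carrier S m.
        S1_mult m x (Some a) = S1_mult m y (Some a) \<longleftrightarrow>
        S1_mult m x (Some b) = S1_mult m y (Some b))"

text \<open>Maps are composed from left to right: the product of \<open>\<alpha>\<close> and \<open>\<beta>\<close> applies \<open>\<alpha>\<close> first.\<close>

definition map_mult :: "'a set \<Rightarrow> ('a \<Rightarrow> 'a) \<Rightarrow> ('a \<Rightarrow> 'a) \<Rightarrow> 'a \<Rightarrow> 'a" where
  "map_mult A \<alpha> \<beta> = compose A \<beta> \<alpha>"

definition T_semi :: "'a set \<Rightarrow> 'a operation set \<Rightarrow> 'a set \<Rightarrow> ('a \<Rightarrow> 'a) set" where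
  "T_semi A F B = {\<alpha> \<in> endo A F. \<alpha> ` A \<subseteq> B}"

definition Q_set :: "'a set \<Rightarrow> 'a operation set \<Rightarrow> 'a set \<Rightarrow> ('a \<Rightarrow> 'a) set" where
  "Q_set A F B = {\<alpha> \<in> T_semi A F B. \<alpha> ` A \<subseteq> \<alpha> ` B}"

definition map_ker :: "'a set \<Rightarrow> ('a \<Rightarrow> 'a) \<Rightarrow> ('a \<times> 'a) set" where
  "map_ker A \<alpha> = {(x, y). x \<in> A \<and> y \<in> A \<and> \<alpha> x = \<alpha> y}"

end

theory Submission imports Defs begin

text \<open>
  A product \<open>x\<alpha>\<close> with \<open>x \<in> T\<close> sees \<open>\<alpha>\<close> only through its restriction to \<open>B\<close>, so equations
  \<open>x\<alpha> = y\<alpha>\<close> over \<open>T\<close> determine exactly \<open>ker \<alpha> \<inter> (B \<times> B)\<close>: for one inclusion take \<open>x\<close> and \<open>y\<close>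
  constant on a basis of \<open>A\<close>, with values \<open>a\<close> and \<open>b\<close> in \<open>B\<close>. The equations \<open>\<alpha> = y\<alpha>\<close>, where the
  adjoined identity occurs, are solvable exactly when \<open>\<alpha> \<in> Q\<close>, and then they reduce the whole
  kernel of \<open>\<alpha>\<close> to its part in \<open>B \<times> B\<close>. Since \<open>B\<close> is proper and has two
  elements, \<open>T\<close> has no identity, so these equations are indeed available.
\<close>

section \<open>Term operations and generated subalgebras\<close>

lemma term_op_reindex:
  assumes "term_op F n t" and "\<And>i. i < n \<Longrightarrow> \<sigma> i < m"
  shows "term_op F m (\<lambda>as. t (map (\<lambda>i. as ! \<sigma> i) [0..<n]))"
  using assms(1)
proof induction
  case (proj i)
  have "term_op F m (\<lambda>as. as ! \<sigma> i)" by (rule term_op.proj[OF assms(2)[OF proj]])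
  then show ?case using proj by simp
next
  case (comp k f ts)
  let ?r = "\<lambda>t as. t (map (\<lambda>i. as ! \<sigma> i) [0..<n])"
  have "term_op F m (\<lambda>as. f (map (\<lambda>t. t as) (map ?r ts)))"
    by (rule term_op.comp[OF comp(1)]) (use comp in auto)
  then show ?case by (simp add: comp_def)
qed

lemma term_op_append_left:
  assumes "term_op F (length as) t"
  shows "\<exists>t'. term_op F (length (as @ bs)) t' \<and> t' (as @ bs) = t as"
proof (intro exI conjI)
  show "term_op F (length (as @ bs)) (\<lambda>cs. t (map (\<lambda>i. cs ! i) [0..<length as]))"
    by (rule term_op_reindex[OF assms]) simp
  have "map (\<lambda>i. (as @ bs) ! i) [0..<length as] = as"
    by (rule nth_equalityI) (auto simp: nth_append)
  then show "t (map (\<lambda>i. (as @ bs) ! i) [0..<length as]) = t as" by simp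
qed

lemma term_op_append_right:
  assumes "term_op F (length bs) t"
  shows "\<exists>t'. term_op F (length (as @ bs)) t' \<and> t' (as @ bs) = t bs"
proof (intro exI conjI)
  show "term_op F (length (as @ bs)) (\<lambda>cs. t (map (\<lambda>i. cs ! (length as + i)) [0..<length bs]))"
    by (rule term_op_reindex[OF assms]) simp
  have "map (\<lambda>i. (as @ bs) ! (length as + i)) [0..<length bs] = bs"
    by (rule nth_equalityI) auto
  then show "t (map (\<lambda>i. (as @ bs) ! (length as + i)) [0..<length bs]) = t bs" by simp
qed

lemma genI: "term_op F (length as) t \<Longrightarrow> set as \<subseteq> X \<Longrightarrow> t as \<in> gen F X"
  unfolding gen_def by blast

text \<open>The terms witnessing membership of the various \<open>z\<close> come with different
  argument lists. Concatenating these lists and reindexing the projections gives one list for all of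
  them, as \<open>term_op.comp\<close> requires.\<close>

lemma gen_common_args:
  assumes "set zs \<subseteq> gen F X"
  shows "\<exists>as ts. set as \<subseteq> X \<and> (\<forall>t\<in>set ts. term_op F (length as) t) \<and> zs = map (\<lambda>t. t as) ts"
  using assms
proof (induction zs)
  case Nil
  show ?case by (intro exI[of _ "[]"]) simp
next
  case (Cons z zs)
  then obtain bs ts where bs: "set bs \<subseteq> X" "\<forall>t\<in>set ts. term_op F (length bs) t"
    "zs = map (\<lambda>t. t bs) ts" by auto
  from Cons obtain as t where t: "z = t as" "term_op F (length as) t" "set as \<subseteq> X"
    by (auto simp: gen_def)
  obtain t' where t': "term_op F (length (as @ bs)) t'" "t' (as @ bs) = t as"
    using term_op_append_left[OF t(2)] by blast
  have "\<forall>s\<in>set ts. \<exists>s'. term_op F (length (as @ bs)) s' \<and> s' (as @ bs) = s bs"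
    using bs(2) term_op_append_right by metis
  then obtain r where r: "\<forall>s\<in>set ts. term_op F (length (as @ bs)) (r s) \<and> r s (as @ bs) = s bs"
    by metis
  have "z # zs = map (\<lambda>t. t (as @ bs)) (t' # map r ts)"
    using r t' t bs by simp
  moreover have "\<forall>t\<in>set (t' # map r ts). term_op F (length (as @ bs)) t"
    using r t' by auto
  ultimately show ?case
    using t(3) bs(1) by (metis set_append Un_subset_iff)
qed

lemma gen_closed:
  assumes "(n, f) \<in> F" and "length zs = n" and "set zs \<subseteq> gen F X"
  shows "f zs \<in> gen F X"
proof -
  obtain as ts where *: "set as \<subseteq> X" "\<forall>t\<in>set ts. term_op F (length as) t" "zs = map (\<lambda>t. t as) ts"
    using gen_common_args[OF assms(3)] by blast
  have "term_op F (length as) (\<lambda>as. f (map (\<lambda>t. t as) ts))"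
    by (rule term_op.comp[OF assms(1)]) (use * assms in auto)
  from genI[OF this *(1)] show ?thesis using * by simp
qed

lemma gen_least:
  assumes "X \<subseteq> C" and closed: "\<And>n f as. (n, f) \<in> F \<Longrightarrow> length as = n \<Longrightarrow> set as \<subseteq> C \<Longrightarrow> f as \<in> C"
  shows "gen F X \<subseteq> C"
proof
  fix y assume "y \<in> gen F X"
  then obtain as t where y: "y = t as" "term_op F (length as) t" "set as \<subseteq> X"
    by (auto simp: gen_def)
  from y(2) have "t as \<in> C"
  proof induction
    case (proj i)
    then have "as ! i \<in> set as" by simp
    then show ?case using y(3) assms(1) by blast
  next
    case (comp m f ts)
    show ?case by (rule closed[OF comp(1)]) (use comp in auto)
  qed
  then show "y \<in> C" using y by simp
qed

lemma gen_superset: "X \<subseteq> gen F X"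
proof
  fix x assume "x \<in> X"
  moreover have "term_op F (length [x]) (\<lambda>as. as ! 0)"
    by (rule term_op.proj) simp
  ultimately show "x \<in> gen F X" using genI[of F "[x]" "\<lambda>as. as ! 0" X] by simp
qed

lemma gen_mono: "X \<subseteq> Y \<Longrightarrow> gen F X \<subseteq> gen F Y"
  by (auto simp: gen_def)

lemma gen_subalgebra:
  assumes "subalgebra A F C" and "X \<subseteq> C"
  shows "gen F X \<subseteq> C"
  by (rule gen_least[OF assms(2)]) (use assms(1) in \<open>auto simp: subalgebra_def\<close>)

lemma gen_finite:
  assumes "y \<in> gen F X"
  obtains Y where "finite Y" and "Y \<subseteq> X" and "y \<in> gen F Y"
proof -
  obtain as t where "y = t as" "term_op F (length as) t" "set as \<subseteq> X"
    using assms by (auto simp: gen_def)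
  then show thesis using that[of "set as"] by (auto simp: gen_def)
qed

lemma indep_empty: "indep F {}"
  by (simp add: indep_def)

text \<open>A dependence of \<open>x\<close> on the rest of the union involves finitely many
  elements by \<open>gen_finite\<close>. These and \<open>x\<close> itself lie in a single member of
  the chain, which would then be dependent. This supplies the upper bounds for Zorn's lemma.\<close>

lemma indep_Union_chain:
  assumes chain: "subset.chain (Collect (indep F)) \<C>" and "\<C> \<noteq> {}"
  shows "indep F (\<Union>\<C>)"
  unfolding indep_def
proof (intro ballI notI)
  fix x assume x: "x \<in> \<Union>\<C>" and "x \<in> gen F (\<Union>\<C> - {x})"
  then obtain Y where Y: "finite Y" "Y \<subseteq> \<Union>\<C> - {x}" "x \<in> gen F Y"
    by (meson gen_finite)
  obtain Z where Z: "Z \<in> \<C>" "insert x Y \<subseteq> Z"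
    using finite_subset_Union_chain[of "insert x Y" \<C> "Collect (indep F)"] assms x Y by auto
  then have "x \<in> gen F (Z - {x})" using Y gen_mono[of Y "Z - {x}" F] by auto
  moreover have "indep F Z" using chain Z by (auto simp: subset.chain_def)
  ultimately show False using Z by (auto simp: indep_def)
qed

section \<open>Endomorphisms and generated subalgebras\<close>

context univ_algebra
begin

lemma subalgebra_universe: "subalgebra A F A"
  using ops_closed by (auto simp: subalgebra_def)

lemma endo_closed: "h \<in> endo A F \<Longrightarrow> x \<in> A \<Longrightarrow> h x \<in> A"
  by (auto simp: endo_def)

text \<open>Membership in \<open>A\<close> is carried through the induction because the homomorphism
  condition in \<open>endo\<close> covers only arguments from \<open>A\<close>.\<close>

lemma endo_term_op:
  assumes "h \<in> endo A F" and "term_op F (length as) t" and "set as \<subseteq> A"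
  shows "t as \<in> A \<and> h (t as) = t (map h as)"
  using assms(2)
proof induction
  case (proj i)
  then have "as ! i \<in> set as" by simp
  then show ?case using assms(3) proj by auto
next
  case (comp m f ts)
  have *: "set (map (\<lambda>t. t as) ts) \<subseteq> A" using comp by auto
  have "h (f (map (\<lambda>t. t as) ts)) = f (map h (map (\<lambda>t. t as) ts))"
    using assms(1) comp(1,2) * unfolding endo_def by simp
  also have "map h (map (\<lambda>t. t as) ts) = map (\<lambda>t. t (map h as)) ts"
    using comp by simp
  finally show ?case using ops_closed[OF comp(1) _ *] comp(2) by simp
qed

text \<open>Both maps commute with the term that produces \<open>y\<close>. Later, equations between
  endomorphisms are checked on a basis and spread by this lemma.\<close>

lemma endo_eq_on_gen:
  assumes "h \<in> endo A F" and "k \<in> endo A F" and "X \<subseteq> A" and "\<And>x. x \<in> X \<Longrightarrow> h x = k x"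
    and "y \<in> gen F X"
  shows "h y = k y"
proof -
  obtain as t where t: "y = t as" "term_op F (length as) t" "set as \<subseteq> X"
    using assms(5) by (auto simp: gen_def)
  have "map h as = map k as" using t assms(4) by auto
  moreover have "set as \<subseteq> A" using t assms(3) by blast
  ultimately show ?thesis
    using endo_term_op[OF assms(1) t(2)] endo_term_op[OF assms(2) t(2)] t(1) by metis
qed

lemma endo_image_gen:
  assumes "h \<in> endo A F" and "X \<subseteq> A" and "subalgebra A F C" and "h ` X \<subseteq> C" and "y \<in> gen F X"
  shows "h y \<in> C"
proof -
  obtain as t where t: "y = t as" "term_op F (length as) t" "set as \<subseteq> X"
    using assms(5) by (auto simp: gen_def)
  have "h y = t (map h as)"
    using endo_term_op[OF assms(1) t(2)] t assms(2) by auto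
  also have "\<dots> \<in> gen F (h ` X)"
    using t by (intro genI) auto
  finally show ?thesis using gen_subalgebra[OF assms(3,4)] by auto
qed

lemma endo_compose:
  assumes "h \<in> endo A F" and "k \<in> endo A F"
  shows "compose A k h \<in> endo A F"
  unfolding endo_def
proof (intro CollectI conjI allI impI)
  show "compose A k h \<in> A \<rightarrow>\<^sub>E A"
    using assms by (auto simp: compose_def endo_def)
  fix n f as assume f: "(n, f) \<in> F" "length as = n" "set as \<subseteq> A"
  have hA: "set (map h as) \<subseteq> A" using f(3) assms(1) endo_closed by auto
  have "compose A k h (f as) = k (h (f as))"
    using ops_closed[OF f] by (simp add: compose_eq)
  also have "h (f as) = f (map h as)" using assms(1) f unfolding endo_def by blast
  also have "k (f (map h as)) = f (map k (map h as))"
    using assms(2) f(1,2) hA unfolding endo_def by simp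
  also have "map k (map h as) = map (compose A k h) as"
    using f(3) by (auto simp: compose_eq)
  finally show "compose A k h (f as) = f (map (compose A k h) as)" .
qed

end

section \<open>Bases and dimension under the exchange property\<close>

context independence_algebra
begin

text \<open>If some \<open>x\<close> in \<open>X\<close> came to depend on the others once
  \<open>c\<close> is added, exchange would put \<open>c\<close> into the span of
  \<open>X - {x}\<close> together with \<open>x\<close>, that is, of \<open>X\<close>.\<close>

lemma indep_insert:
  assumes "indep F X" and "X \<subseteq> A" and "c \<in> A" and "c \<notin> gen F X"
  shows "indep F (insert c X)"
  unfolding indep_def
proof (intro ballI notI)
  have cX: "c \<notin> X" using assms(4) gen_superset[of X F] by blast
  fix x assume x: "x \<in> insert c X" and *: "x \<in> gen F (insert c X - {x})"
  show False
  proof (cases "x = c")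
    case True
    then show False using * cX assms(4) by simp
  next
    case False
    then have xX: "x \<in> X" using x by simp
    then have "insert c X - {x} = insert c (X - {x})" using False by auto
    then have "c \<in> gen F (insert x (X - {x}))"
      using exchange[of "X - {x}" c x] * assms xX unfolding indep_def by auto
    then show False using assms(4) xX by (simp add: insert_absorb)
  qed
qed

text \<open>Zorn's lemma gives a maximal independent set between \<open>Y\<close> and
  \<open>C\<close>. It generates \<open>C\<close>, since by \<open>indep_insert\<close> any element
  of \<open>C\<close> outside its span could be added.\<close>

lemma indep_extends_to_basis:
  assumes C: "subalgebra A F C" and Y: "Y \<subseteq> C" "indep F Y"
  obtains X where "Y \<subseteq> X" and "is_basis F C X"
proof -
  let ?S = "{X. Y \<subseteq> X \<and> X \<subseteq> C \<and> indep F X}"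
  have "\<exists>M\<in>?S. \<forall>X\<in>?S. M \<subseteq> X \<longrightarrow> X = M"
  proof (rule subset_Zorn_nonempty)
    show "?S \<noteq> {}" using Y by auto
    fix \<C> assume "\<C> \<noteq> {}" and chain: "subset.chain ?S \<C>"
    then have "indep F (\<Union>\<C>)"
      by (intro indep_Union_chain) (auto simp: subset.chain_def)
    then show "\<Union>\<C> \<in> ?S" using \<open>\<C> \<noteq> {}\<close> chain by (auto simp: subset.chain_def)
  qed
  then obtain X where "X \<in> ?S" and max: "\<forall>Z\<in>?S. X \<subseteq> Z \<longrightarrow> Z = X" by (elim bexE)
  then have X: "Y \<subseteq> X" "X \<subseteq> C" "indep F X" by auto
  have CA: "C \<subseteq> A" using C by (simp add: subalgebra_def)
  have "C \<subseteq> gen F X"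
  proof
    fix c assume c: "c \<in> C"
    show "c \<in> gen F X"
    proof (rule ccontr)
      assume n: "c \<notin> gen F X"
      then have "indep F (insert c X)" using indep_insert[OF X(3)] X(2) c CA by auto
      then have "insert c X = X" using X c by (intro max[rule_format]) auto
      then show False using n gen_superset[of X F] by auto
    qed
  qed
  then have "is_basis F C X"
    using X gen_subalgebra[OF C X(2)] by (auto simp: is_basis_def)
  then show thesis using X that by blast
qed

lemma basis_exists:
  assumes "subalgebra A F C"
  obtains X where "is_basis F C X"
  using indep_extends_to_basis[OF assms _ indep_empty] by blast

text \<open>Either there are two basis elements, or one basis element and a constant. The latter two
  differ because a constant lies in the span of every set, which independence forbids for a basis
  element.\<close>

lemma two_elements_of_dim:
  assumes C: "subalgebra A F C"
    and dim: "natLeq_on 2 \<le>o alg_dim F C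
         \<or> gen F {} \<noteq> {} \<and> alg_dim F C =o natLeq_on 1"
  obtains a b where "a \<in> C" and "b \<in> C" and "a \<noteq> b"
proof -
  \<comment> \<open>This is the choice made in \<open>alg_dim\<close>, so the cardinal in the
    hypothesis is that of \<open>X\<close>.\<close>
  define X where "X = (SOME X. is_basis F C X)"
  have X: "is_basis F C X"
    unfolding X_def using basis_exists[OF C] by (metis someI)
  \<comment> \<open>The field of \<open>natLeq_on n\<close> is \<open>{0..<n}\<close>, so the
    comparison of cardinals amounts to an injection into \<open>X\<close>.\<close>
  have *: "\<exists>g. inj_on g {0..<n} \<and> g ` {0..<n} \<subseteq> X" if "natLeq_on n \<le>o alg_dim F C" for n
  proof -
    have "{0..<n} = Field (natLeq_on n)"
      by (auto simp: Field_natLeq_on)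
    moreover have "|Field (natLeq_on n)| \<le>o |Field |X| |"
      using card_of_mono2[OF that] unfolding alg_dim_def X_def .
    ultimately show ?thesis by (simp add: card_of_ordLeq Field_card_of)
  qed
  from dim show thesis
  proof
    assume "natLeq_on 2 \<le>o alg_dim F C"
    then obtain g where "inj_on g {0..<2::nat}" "g ` {0..<2::nat} \<subseteq> X" using * by blast
    then have "g 0 \<in> X" "g 1 \<in> X" "g 0 \<noteq> g 1"
      by (auto simp: inj_on_eq_iff image_subset_iff)
    then show thesis using that X by (auto simp: is_basis_def)
  next
    assume h: "gen F {} \<noteq> {} \<and> alg_dim F C =o natLeq_on 1"
    then have "natLeq_on 1 \<le>o alg_dim F C"
      using ordIso_symmetric ordIso_imp_ordLeq by blast
    then obtain g where "g ` {0..<1::nat} \<subseteq> X" using * by blast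
    then have y: "g 0 \<in> X" by auto
    obtain c where c: "c \<in> gen F {}" using h by blast
    have "g 0 \<notin> gen F (X - {g 0})" using X y by (auto simp: is_basis_def indep_def)
    then have "c \<noteq> g 0" using c gen_mono[of "{}" "X - {g 0}" F] by auto
    moreover have "c \<in> C" using c gen_subalgebra[OF C] by auto
    ultimately show thesis using that X y by (auto simp: is_basis_def)
  qed
qed

section \<open>The semigroup T(A,B): extension of maps, identities and left units\<close>

lemma T_semi_extension:
  assumes "is_basis F A X" and "subalgebra A F B" and "g \<in> X \<rightarrow> B"
  obtains h where "h \<in> T_semi A F B" and "\<And>x. x \<in> X \<Longrightarrow> h x = g x"
proof -
  have X: "X \<subseteq> A" "gen F X = A" using assms(1) by (auto simp: is_basis_def)
  have "g \<in> X \<rightarrow> A" using assms(2,3) by (auto simp: subalgebra_def)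
  then obtain h where h: "h \<in> endo A F" "\<forall>x\<in>X. h x = g x"
    using free_basis[OF assms(1)] by blast
  have "h ` A \<subseteq> B"
    using endo_image_gen[OF h(1) X(1) assms(2)] h(2) assms(3) X(2) by fastforce
  then show thesis using that h by (auto simp: T_semi_def)
qed

text \<open>A left identity \<open>e\<close> would force \<open>h (e z) = h z\<close> for all
  \<open>h\<close> in T. As \<open>B\<close> is proper, a basis \<open>Y\<close> of \<open>B\<close>
  extends to a basis of \<open>A\<close> with a new element \<open>z\<close>. A map \<open>h\<close>
  that fixes \<open>Y\<close>, and so \<open>B\<close>, keeps \<open>e z\<close> in place, yet it
  may send \<open>z\<close> to any other element \<open>c\<close> of \<open>B\<close>.\<close>

lemma T_semi_no_identity:
  assumes B: "subalgebra A F B" "B \<noteq> A" and two: "a \<in> B" "b \<in> B" "a \<noteq> b"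
  shows "\<not> (\<exists>e\<in>T_semi A F B. \<forall>x\<in>T_semi A F B. map_mult A e x = x \<and> map_mult A x e = x)"
proof
  assume "\<exists>e\<in>T_semi A F B. \<forall>x\<in>T_semi A F B. map_mult A e x = x \<and> map_mult A x e = x"
  then obtain e where e: "e \<in> T_semi A F B" "\<And>x. x \<in> T_semi A F B \<Longrightarrow> map_mult A e x = x" by blast
  obtain Y where Y: "is_basis F B Y" using basis_exists[OF B(1)] .
  have BA: "B \<subseteq> A" using B by (simp add: subalgebra_def)
  obtain X where X: "Y \<subseteq> X" "is_basis F A X"
    using indep_extends_to_basis[OF subalgebra_universe, of Y] Y BA by (auto simp: is_basis_def)
  have XA: "X \<subseteq> A" using X by (simp add: is_basis_def)
  have "X \<noteq> Y" using X Y B(2) by (auto simp: is_basis_def)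
  then obtain z where z: "z \<in> X" "z \<notin> Y" using X by blast
  have ez: "e z \<in> B" using e z XA by (auto simp: T_semi_def)
  obtain c where c: "c \<in> B" "c \<noteq> e z" using two by metis
  define g where "g x = (if x \<in> Y then x else c)" for x
  have "g \<in> X \<rightarrow> B"
    using Y c by (auto simp: g_def is_basis_def)
  then obtain h where h: "h \<in> T_semi A F B" "\<And>x. x \<in> X \<Longrightarrow> h x = g x"
    using T_semi_extension[OF X(2) B(1)] by blast
  \<comment> \<open>The restriction makes the identity extensional, as \<open>endo\<close> demands.
    Since \<open>h\<close> agrees with it on \<open>Y\<close>, it fixes every element of
    \<open>B\<close>, in particular \<open>e z\<close>.\<close>
  have id: "restrict id A \<in> endo A F"
  proof -
    have "map (restrict id A) as = as" if "set as \<subseteq> A" for as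
      using that by (intro map_idI) auto
    then show ?thesis using ops_closed by (auto simp: endo_def)
  qed
  have "h (e z) = restrict id A (e z)"
    by (rule endo_eq_on_gen[OF _ id, of _ Y]) (use h X XA Y ez in \<open>auto simp: g_def T_semi_def is_basis_def\<close>)
  then have "h (e z) = e z" using ez BA by auto
  moreover have "h (e z) = h z"
    using fun_cong[OF e(2)[OF h(1)], of z] z XA by (simp add: map_mult_def compose_eq subset_iff)
  ultimately show False using h(2)[OF z(1)] z c by (simp add: g_def)
qed

text \<open>For \<open>\<alpha>\<close> in Q each basis element of \<open>A\<close> can be sent to a
  point of \<open>B\<close> with the same value under \<open>\<alpha>\<close>; the extension
  \<open>y\<close> of this choice satisfies the equation on the basis, hence everywhere. Conversely,
  \<open>\<alpha> z = \<alpha> (y z)\<close> with \<open>y z\<close> in \<open>B\<close>.\<close>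

lemma Q_set_iff_left_unit:
  assumes B: "subalgebra A F B" and \<alpha>: "\<alpha> \<in> T_semi A F B"
  shows "\<alpha> \<in> Q_set A F B \<longleftrightarrow> (\<exists>y\<in>T_semi A F B. map_mult A y \<alpha> = \<alpha>)"
proof
  assume Q: "\<alpha> \<in> Q_set A F B"
  obtain X where X: "is_basis F A X" using basis_exists[OF subalgebra_universe] .
  have XA: "X \<subseteq> A" "gen F X = A" using X by (auto simp: is_basis_def)
  have "\<forall>x\<in>X. \<exists>b\<in>B. \<alpha> b = \<alpha> x" using Q XA by (fastforce simp: Q_set_def)
  then obtain g where g: "\<forall>x\<in>X. g x \<in> B \<and> \<alpha> (g x) = \<alpha> x" by metis
  then obtain y where y: "y \<in> T_semi A F B" "\<And>x. x \<in> X \<Longrightarrow> y x = g x"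
    using T_semi_extension[OF X B, of g] by blast
  have "compose A \<alpha> y z = \<alpha> z" if "z \<in> A" for z
    by (rule endo_eq_on_gen[OF endo_compose, of _ _ _ X])
      (use y \<alpha> XA g that in \<open>auto simp: T_semi_def compose_def\<close>)
  then have "compose A \<alpha> y = \<alpha>"
    using \<alpha> by (intro extensionalityI[of _ A]) (auto simp: T_semi_def endo_def PiE_def)
  then show "\<exists>y\<in>T_semi A F B. map_mult A y \<alpha> = \<alpha>"
    using y by (auto simp: map_mult_def)
next
  assume "\<exists>y\<in>T_semi A F B. map_mult A y \<alpha> = \<alpha>"
  then obtain y where y: "y \<in> T_semi A F B" "map_mult A y \<alpha> = \<alpha>" by blast
  have "\<alpha> z \<in> \<alpha> ` B" if "z \<in> A" for z
  proof -
    have "\<alpha> z = \<alpha> (y z)" using fun_cong[OF y(2), of z] that by (simp add: map_mult_def compose_eq)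
    then show ?thesis using y that by (auto simp: T_semi_def)
  qed
  then show "\<alpha> \<in> Q_set A F B" using \<alpha> by (auto simp: Q_set_def)
qed

text \<open>One implication between the equations gives one inclusion of the kernels on
  \<open>B\<close>; exchanging \<open>\<alpha>\<close> and \<open>\<beta>\<close> gives the
  other.\<close>

lemma kernel_eq_from_products:
  assumes B: "subalgebra A F B" "B \<noteq> A"
    and \<alpha>: "\<alpha> \<in> T_semi A F B" and ab: "a \<in> B" "b \<in> B" "\<alpha> a = \<alpha> b"
    and imp: "\<And>x y. x \<in> T_semi A F B \<Longrightarrow> y \<in> T_semi A F B \<Longrightarrow>
      map_mult A x \<alpha> = map_mult A y \<alpha> \<Longrightarrow> map_mult A x \<beta> = map_mult A y \<beta>"
  shows "\<beta> a = \<beta> b"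
proof -
  obtain X where X: "is_basis F A X" using basis_exists[OF subalgebra_universe] .
  have XA: "X \<subseteq> A" "gen F X = A" using X by (auto simp: is_basis_def)
  \<comment> \<open>With an empty basis \<open>A\<close> would be the span of the empty set, which
    lies in \<open>B\<close>, contrary to \<open>B \<noteq> A\<close>.\<close>
  have "X \<noteq> {}"
    using XA gen_subalgebra[OF B(1), of "{}"] B by (auto simp: subalgebra_def)
  then obtain z where z: "z \<in> X" by blast
  obtain x where x: "x \<in> T_semi A F B" "\<And>w. w \<in> X \<Longrightarrow> x w = a"
    using T_semi_extension[OF X B(1), of "\<lambda>_. a"] ab by blast
  obtain y where y: "y \<in> T_semi A F B" "\<And>w. w \<in> X \<Longrightarrow> y w = b"
    using T_semi_extension[OF X B(1), of "\<lambda>_. b"] ab by blast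
  \<comment> \<open>Off the basis \<open>x\<close> and \<open>y\<close> need not be constant, so the
    products are compared on \<open>X\<close> only.\<close>
  have "compose A \<alpha> x w = compose A \<alpha> y w" if "w \<in> A" for w
    by (rule endo_eq_on_gen[OF endo_compose endo_compose, of _ _ _ _ X])
      (use x y \<alpha> XA ab that in \<open>auto simp: T_semi_def compose_def\<close>)
  then have "compose A \<alpha> x = compose A \<alpha> y"
    by (intro extensionalityI[of _ A]) auto
  then have "compose A \<beta> x = compose A \<beta> y" using imp[OF x(1) y(1)] by (simp only: map_mult_def)
  from fun_cong[OF this, of z] show ?thesis using z XA x y by (auto simp: compose_eq)
qed

end

section \<open>Pointwise form of the equations that define the relation\<close>

lemma map_mult_eq_iff:
  "map_mult A x \<alpha> = map_mult A y \<alpha> \<longleftrightarrow> (\<forall>z\<in>A. \<alpha> (x z) = \<alpha> (y z))"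
proof
  assume "map_mult A x \<alpha> = map_mult A y \<alpha>"
  then show "\<forall>z\<in>A. \<alpha> (x z) = \<alpha> (y z)" by (metis map_mult_def compose_eq)
next
  assume "\<forall>z\<in>A. \<alpha> (x z) = \<alpha> (y z)"
  then show "map_mult A x \<alpha> = map_mult A y \<alpha>"
    unfolding map_mult_def by (intro extensionalityI[of _ A]) (auto simp: compose_eq)
qed

text \<open>Membership in T makes \<open>\<alpha>\<close> extensional, so that it agrees with the
  composite outside \<open>A\<close> as well.\<close>

lemma map_mult_eq_self_iff:
  assumes "\<alpha> \<in> T_semi A F B"
  shows "map_mult A y \<alpha> = \<alpha> \<longleftrightarrow> (\<forall>z\<in>A. \<alpha> (y z) = \<alpha> z)"
proof
  assume "map_mult A y \<alpha> = \<alpha>"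
  then show "\<forall>z\<in>A. \<alpha> (y z) = \<alpha> z" by (metis map_mult_def compose_eq)
next
  assume "\<forall>z\<in>A. \<alpha> (y z) = \<alpha> z"
  then show "map_mult A y \<alpha> = \<alpha>" using assms
    unfolding map_mult_def by (intro extensionalityI[of _ A]) (auto simp: compose_eq T_semi_def endo_def PiE_def)
qed

text \<open>Here \<open>None\<close> belongs to the carrier of the monoid. Pairs from
  \<open>S\<close> give the first conjunct, pairs with exactly one \<open>None\<close> the second,
  and the pair of two \<open>None\<close> is trivial.\<close>

lemma R_star_iff_no_identity:
  assumes "\<not> (\<exists>e\<in>S. \<forall>x\<in>S. m e x = x \<and> m x e = x)" and "a \<in> S" and "b \<in> S"
  shows "R_star S m a b \<longleftrightarrow>
    (\<forall>x\<in>S. \<forall>y\<in>S. m x a = m y a \<longleftrightarrow> m x b = m y b) \<and> (\<forall>y\<in>S. m y a = a \<longleftrightarrow> m y b = b)"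
proof -
  have "S1_carrier S m = insert None (Some ` S)"
    using assms(1) unfolding S1_carrier_def by (rule if_not_P)
  then show ?thesis
    using assms(2,3) unfolding R_star_def by (auto simp: eq_commute[of a] eq_commute[of b])
qed

theorem proposition6p3:
  fixes A B :: "'a set" and F :: "'a operation set" and \<alpha> \<beta> :: "'a \<Rightarrow> 'a"
  assumes "independence_algebra A F"
    and "subalgebra A F B" and "B \<noteq> {}" and "B \<noteq> A"
    and "natLeq_on 2 \<le>o alg_dim F B
         \<or> gen F {} \<noteq> {} \<and> alg_dim F B =o natLeq_on 1"
    and "\<alpha> \<in> T_semi A F B" and "\<beta> \<in> T_semi A F B"
  shows "R_star (T_semi A F B) (map_mult A) \<alpha> \<beta> \<longleftrightarrow>
      (map_ker A \<alpha> = map_ker A \<beta> \<and> \<alpha> \<in> Q_set A F B \<and> \<beta> \<in> Q_set A F B) \<or>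
      (map_ker A \<alpha> \<inter> (B \<times> B) = map_ker A \<beta> \<inter> (B \<times> B)
         \<and> \<alpha> \<notin> Q_set A F B \<and> \<beta> \<notin> Q_set A F B)"
proof -
  interpret independence_algebra A F by (rule assms(1))
  let ?T = "T_semi A F B"
  note B = assms(2) and \<alpha> = assms(6) and \<beta> = assms(7)
  have BA: "B \<subseteq> A" using B by (simp add: subalgebra_def)
  have TB: "x z \<in> B" if "x \<in> ?T" "z \<in> A" for x z using that by (auto simp: T_semi_def)
  obtain a b where ab: "a \<in> B" "b \<in> B" "a \<noteq> b"
    using two_elements_of_dim[OF B assms(5)] by blast
  note no_id = T_semi_no_identity[OF B assms(4) ab]
  note R = R_star_iff_no_identity[OF no_id \<alpha> \<beta>]
  note Q\<alpha> = Q_set_iff_left_unit[OF B \<alpha>] and Q\<beta> = Q_set_iff_left_unit[OF B \<beta>]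
  note self = map_mult_eq_self_iff[OF \<alpha>] map_mult_eq_self_iff[OF \<beta>]
  show ?thesis
  proof
    assume "R_star ?T (map_mult A) \<alpha> \<beta>"
    then have R1: "\<And>x y. x \<in> ?T \<Longrightarrow> y \<in> ?T \<Longrightarrow>
        map_mult A x \<alpha> = map_mult A y \<alpha> \<longleftrightarrow> map_mult A x \<beta> = map_mult A y \<beta>"
      and R2: "\<And>y. y \<in> ?T \<Longrightarrow> map_mult A y \<alpha> = \<alpha> \<longleftrightarrow> map_mult A y \<beta> = \<beta>"
      using R by auto
    have ker: "\<alpha> a = \<alpha> b \<longleftrightarrow> \<beta> a = \<beta> b" if "a \<in> B" "b \<in> B" for a b
      using kernel_eq_from_products[OF B assms(4) \<alpha> that, of \<beta>]
        kernel_eq_from_products[OF B assms(4) \<beta> that, of \<alpha>] R1 by blast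
    \<comment> \<open>Membership in Q means solvability of the left unit equation, and by
      \<open>R2\<close> both equations have the same solutions.\<close>
    have QQ: "\<alpha> \<in> Q_set A F B \<longleftrightarrow> \<beta> \<in> Q_set A F B" using Q\<alpha> Q\<beta> R2 by blast
    show "(map_ker A \<alpha> = map_ker A \<beta> \<and> \<alpha> \<in> Q_set A F B \<and> \<beta> \<in> Q_set A F B) \<or>
      (map_ker A \<alpha> \<inter> (B \<times> B) = map_ker A \<beta> \<inter> (B \<times> B)
         \<and> \<alpha> \<notin> Q_set A F B \<and> \<beta> \<notin> Q_set A F B)"
    proof (cases "\<alpha> \<in> Q_set A F B")
      case True
      then obtain y where y: "y \<in> ?T" "map_mult A y \<alpha> = \<alpha>" using Q\<alpha> by blast
      \<comment> \<open>A single \<open>y\<close> is a left unit for both maps. It moves every pair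
        from \<open>A\<close> into \<open>B\<close> without changing the values under
        \<open>\<alpha>\<close> and \<open>\<beta>\<close>, so the kernels on \<open>B\<close>
        decide the whole kernels.\<close>
      then have "\<forall>z\<in>A. \<alpha> (y z) = \<alpha> z" "\<forall>z\<in>A. \<beta> (y z) = \<beta> z" using R2 self by auto
      then have "\<alpha> u = \<alpha> v \<longleftrightarrow> \<beta> u = \<beta> v" if "u \<in> A" "v \<in> A" for u v
        using ker[of "y u" "y v"] TB[OF y(1)] that by simp
      then show ?thesis using True QQ by (auto simp: map_ker_def)
    next
      case False
      then show ?thesis using ker QQ by (auto simp: map_ker_def)
    qed
  next
    assume rhs: "(map_ker A \<alpha> = map_ker A \<beta> \<and> \<alpha> \<in> Q_set A F B \<and> \<beta> \<in> Q_set A F B) \<or>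
      (map_ker A \<alpha> \<inter> (B \<times> B) = map_ker A \<beta> \<inter> (B \<times> B)
         \<and> \<alpha> \<notin> Q_set A F B \<and> \<beta> \<notin> Q_set A F B)"
    then have "map_ker A \<alpha> \<inter> (B \<times> B) = map_ker A \<beta> \<inter> (B \<times> B)" by blast
    then have ker: "\<alpha> u = \<alpha> v \<longleftrightarrow> \<beta> u = \<beta> v" if "u \<in> B" "v \<in> B" for u v
      using that BA by (auto simp: map_ker_def set_eq_iff)
    have "map_mult A x \<alpha> = map_mult A y \<alpha> \<longleftrightarrow> map_mult A x \<beta> = map_mult A y \<beta>"
      if "x \<in> ?T" "y \<in> ?T" for x y
      using ker TB that by (auto simp: map_mult_eq_iff)
    \<comment> \<open>Now \<open>\<alpha>\<close> is compared at \<open>y z\<close> and at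
      \<open>z\<close>, which may lie outside \<open>B\<close>. In the first case the full kernels
      agree; in the second neither equation has a solution in T.\<close>
    moreover have "map_mult A y \<alpha> = \<alpha> \<longleftrightarrow> map_mult A y \<beta> = \<beta>" if y: "y \<in> ?T" for y
      using rhs
    proof
      assume "map_ker A \<alpha> = map_ker A \<beta> \<and> \<alpha> \<in> Q_set A F B \<and> \<beta> \<in> Q_set A F B"
      then have "\<alpha> u = \<alpha> v \<longleftrightarrow> \<beta> u = \<beta> v" if "u \<in> A" "v \<in> A" for u v
        using that by (auto simp: map_ker_def set_eq_iff)
      moreover have "y z \<in> A" if "z \<in> A" for z using TB[OF y that] BA by blast
      ultimately show ?thesis unfolding self by simp
    next
      assume "map_ker A \<alpha> \<inter> (B \<times> B) = map_ker A \<beta> \<inter> (B \<times> B)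
         \<and> \<alpha> \<notin> Q_set A F B \<and> \<beta> \<notin> Q_set A F B"
      then show ?thesis using y Q\<alpha> Q\<beta> by blast
    qed
    ultimately show "R_star ?T (map_mult A) \<alpha> \<beta>" unfolding R by blast
  qed
qed

end
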